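(* Let $T\in(0,\infty]$, $\varphi,\psi\in\mathbb{R}$, let $a,b:[0,T)\to\mathbb{R}$ be continuous, and let $\omega_0>0$ and $\omega_1\in\mathbb{R}$ be given. Let $v_1$ and $v_2$ be the solutions of $v''+a\,v'+b\,v=0$ on $(0,T)$ with initial data $$v_1(0)=0,\quad v_1'(0)=1,\qquad v_2(0)=\frac{1}{\omega_0},\quad v_2'(0)=-\frac{1}{\omega_0}\left(\frac{a(0)}{2}+\frac{\omega_1}{2\,\omega_0}\right).$$ Let $\omega$ be either of the following two functions: (i) (real-valued variant, for $v_1^2(0)+v_2^2(0)>0$) $$\omega(t):=\frac{v_1'(t)\,v_2(t)-v_1(t)\,v_2'(t)}{v_1^2(t)+v_2^2(t)};$$ (ii) (imaginary-valued variant, for $v_2^2(0)-v_1^2(0)>0$) $$\omega(t):=\mathrm{i}\,\epsilon(t):=\mathrm{i}\,\frac{v_1'(t)\,v_2(t)-v_1(t)\,v_2'(t)}{v_2^2(t)-v_1^2(t)}.$$ Then, in either case, the frequency function $\omega$ is well-defined on $[0,T)$ (that is, the denominator $v_1^2+v_2^2$ in case (i), respectively $v_2^2-v_1^2$ in case (ii), has no zeros on $[0,T)$, and $\omega$ is a frequency function for $a,b$ on $[0,T)$), with $\omega(0)=\omega_0$ and $\omega'(0)=\omega_1$ in case (i), respectively $\epsilon(0)=\omega_0$ and $\epsilon'(0)=\omega_1$ (i.e. $\omega(0)=\mathrm{i}\,\omega_0$, $\omega'(0)=\mathrm{i}\,\omega_1$) in case (ii). Moreover, the solution $v$ of $$v''+a\,v'+b\,v=0\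 \text{ on }(0,T),\qquad v(0)=\varphi,\quad v'(0)=\psi,$$ is given for $t\in[0,T)$ by $$v(t)=\left[\varphi\,\cos\left(\tilde\omega(t)\right)+\left(\psi+\alpha(0)\,\varphi\right)\frac{\sin\left(\tilde\omega(t)\right)}{\omega(0)}\right]\varrho(t),$$ where $\alpha:=\frac{a}{2}+\frac{\omega'}{2\,\omega}$ and $\varrho:=\exp(-\tilde\alpha)\,H$.
   Context: For an integrable function $g$ write $\tilde g(t):=\int_0^t g(s)\,ds$. $H$ is the Heaviside function, equal to $1$ for $t\ge 0$ and $0$ for $t<0$. Values at $t=0$ are understood as one-sided limits from the right. For imaginary-valued $\omega$, $\cos$ and $\sin$ are the complex functions. Frequency function: for continuous $a,b:[0,T)\to\mathbb{R}$, a differentiable function $\omega:(0,T)\to\mathbb{R}\cup \mathrm{i}\mathbb{R}$ (with $\omega(0):=\omega(0+)$) is called a frequency function for $a,b$ if for all $t\in(0,T)$ $$\int_0^t\omega^2(s)\,ds=\int_0^t\left[b(s)-\left(\frac{a(s)}{2}\right)^2+\left(\frac{\omega'}{2\omega}\right)^2(s)\right]ds-\frac{a(t)}{2}+\frac{a(0)}{2}-\frac{\omega'}{2\omega}(t)+\frac{\omega'}{2\omega}(0).$$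
   Formalization: In case (ii) v2²−v1² may vanish on [0,T) (a=0, b=1, ω0=1, ω1=0 gives cos 2t); so it is shown nonzero only on some [0,S), and the remaining conclusions hold on every [0,S), S≤T, where v2²−v1² has no zeros (S=T included). *)

theory Defs
  imports "HOL-Analysis.Analysis"
begin

text \<open>The right end point may be \<open>\<infinity>\<close>.\<close>

definition Ico0 :: "ereal \<Rightarrow> real set"
  where "Ico0 T = {t. 0 \<le> t \<and> ereal t < T}"

definition Ioo0 :: "ereal \<Rightarrow> real set"
  where "Ioo0 T = {t. 0 < t \<and> ereal t < T}"

text \<open>
  Values at \<open>t = 0\<close> are one-sided limits from the right.  In general \<^const>\<open>Lim\<close> is only meaningful
  if the limit exists; every definition below that relies on such a value therefore also demands
  convergence.
\<close>

definition right_val :: "(real \<Rightarrow> 'a::t2_space) \<Rightarrow> real \<Rightarrow> 'a"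
  where "right_val f t = (if t = 0 then Lim (at_right 0) f else f t)"

definition dt :: "(real \<Rightarrow> 'a::real_normed_vector) \<Rightarrow> real \<Rightarrow> 'a"
  where "dt f = right_val (\<lambda>t. vector_derivative f (at t))"

definition ivp_solution ::
    "ereal \<Rightarrow> (real \<Rightarrow> real) \<Rightarrow> (real \<Rightarrow> real) \<Rightarrow> real \<Rightarrow> real \<Rightarrow> (real \<Rightarrow> real) \<Rightarrow> bool"
  where "ivp_solution T a b x0 x1 v \<longleftrightarrow>
    (\<forall>t\<in>Ioo0 T. v differentiable (at t) \<and> dt v differentiable (at t) \<and>
       dt (dt v) t + a t * dt v t + b t * v t = 0) \<and>
    v 0 = x0 \<and> (v \<longlongrightarrow> x0) (at_right 0) \<and> (dt v \<longlongrightarrow> x1) (at_right 0)"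

text \<open>The function \<open>\<omega>' / (2 \<omega>)\<close>.\<close>

definition half_logderiv :: "(real \<Rightarrow> complex) \<Rightarrow> real \<Rightarrow> complex"
  where "half_logderiv \<omega> = right_val (\<lambda>t. vector_derivative \<omega> (at t) / (2 * \<omega> t))"

text \<open>
  A function with values in the union of the real and the imaginary axis is represented as a
  complex-valued one.  That \<open>\<omega>\<close> has no zeros, that the limits at \<open>0\<close> exist and that the
  integrands are (Lebesgue) integrable is implicit in the defining identity making sense; for
  absolutely integrable functions \<^const>\<open>integral\<close> is the Lebesgue integral.
\<close>

definition frequency_function ::
    "ereal \<Rightarrow> (real \<Rightarrow> real) \<Rightarrow> (real \<Rightarrow> real) \<Rightarrow> (real \<Rightarrow> complex) \<Rightarrow> bool"
  where "frequency_function T a b \<omega> \<longleftrightarrow>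
    (\<forall>t\<in>Ioo0 T. \<omega> differentiable (at t) \<and> \<omega> t \<noteq> 0 \<and> (Im (\<omega> t) = 0 \<or> Re (\<omega> t) = 0)) \<and>
    (\<omega> \<longlongrightarrow> \<omega> 0) (at_right 0) \<and>
    (half_logderiv \<omega> \<longlongrightarrow> half_logderiv \<omega> 0) (at_right 0) \<and>
    (\<forall>t\<in>Ioo0 T.
       (\<lambda>s. (\<omega> s)\<^sup>2) absolutely_integrable_on {0..t} \<and>
       (\<lambda>s. of_real (b s - (a s / 2)\<^sup>2) + (half_logderiv \<omega> s)\<^sup>2) absolutely_integrable_on {0..t} \<and>
       integral {0..t} (\<lambda>s. (\<omega> s)\<^sup>2) =
         integral {0..t} (\<lambda>s. of_real (b s - (a s / 2)\<^sup>2) + (half_logderiv \<omega> s)\<^sup>2)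
         - of_real (a t / 2) + of_real (a 0 / 2) - half_logderiv \<omega> t + half_logderiv \<omega> 0)"

definition wronskian :: "(real \<Rightarrow> real) \<Rightarrow> (real \<Rightarrow> real) \<Rightarrow> real \<Rightarrow> real"
  where "wronskian v1 v2 t = dt v1 t * v2 t - v1 t * dt v2 t"

definition omega_real :: "(real \<Rightarrow> real) \<Rightarrow> (real \<Rightarrow> real) \<Rightarrow> real \<Rightarrow> complex"
  where "omega_real v1 v2 t = of_real (wronskian v1 v2 t / ((v1 t)\<^sup>2 + (v2 t)\<^sup>2))"

definition omega_imag :: "(real \<Rightarrow> real) \<Rightarrow> (real \<Rightarrow> real) \<Rightarrow> real \<Rightarrow> complex"
  where "omega_imag v1 v2 t = \<i> * of_real (wronskian v1 v2 t / ((v2 t)\<^sup>2 - (v1 t)\<^sup>2))"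

definition antideriv0 :: "(real \<Rightarrow> complex) \<Rightarrow> real \<Rightarrow> complex"
  where "antideriv0 g t = integral {0..t} g"

definition heaviside :: "real \<Rightarrow> complex"
  where "heaviside t = (if 0 \<le> t then 1 else 0)"

definition alpha :: "(real \<Rightarrow> real) \<Rightarrow> (real \<Rightarrow> complex) \<Rightarrow> real \<Rightarrow> complex"
  where "alpha a \<omega> t = of_real (a t / 2) + half_logderiv \<omega> t"

definition rho :: "(real \<Rightarrow> real) \<Rightarrow> (real \<Rightarrow> complex) \<Rightarrow> real \<Rightarrow> complex"
  where "rho a \<omega> t = exp (- antideriv0 (alpha a \<omega>) t) * heaviside t"

text \<open>
  ``The solution of the initial value problem on \<open>(0,T)\<close> is given on \<open>[0,T)\<close> by the formula'':
  the antiderivatives in the formula make sense, a solution exists, and every solution agrees with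
  the formula on \<open>[0,T)\<close>.
\<close>

definition solution_given_by ::
    "ereal \<Rightarrow> (real \<Rightarrow> real) \<Rightarrow> (real \<Rightarrow> real) \<Rightarrow> (real \<Rightarrow> complex) \<Rightarrow> real \<Rightarrow> real \<Rightarrow> bool"
  where "solution_given_by T a b \<omega> \<phi> \<psi> \<longleftrightarrow>
    (\<forall>t\<in>Ico0 T. \<omega> absolutely_integrable_on {0..t} \<and> alpha a \<omega> absolutely_integrable_on {0..t}) \<and>
    (\<exists>v. ivp_solution T a b \<phi> \<psi> v) \<and>
    (\<forall>v. ivp_solution T a b \<phi> \<psi> v \<longrightarrow>
      (\<forall>t\<in>Ico0 T. of_real (v t) =
        (of_real \<phi> * cos (antideriv0 \<omega> t)
          + (of_real \<psi> + alpha a \<omega> 0 * of_real \<phi>) * (sin (antideriv0 \<omega> t) / \<omega> 0))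
        * rho a \<omega> t))"

end

theory Submission imports Defs
begin

text \<open>
  Both variants are treated at once, with \<open>c = 1\<close> or \<open>c = \<i>\<close>, \<open>\<sigma> = c\<^sup>2\<close>,
  \<open>q = \<sigma> v1\<^sup>2 + v2\<^sup>2\<close> and \<open>\<omega> = c W / q\<close>, where \<open>W\<close> is the Wronskian.  Abel's identity
  \<open>W' = - a W\<close> gives \<open>\<omega>' / (2 \<omega>) = - a / 2 - q' / (2 q)\<close>, and the defining identity of a frequency
  function is the integrated Riccati-type equation for \<open>q' / (2 q)\<close>.  Moreover \<open>\<alpha> = - q' / (2 q)\<close>,
  so \<open>\<rho>\<close> is \<open>sqrt q\<close> up to a constant, and \<open>v2\<close> and \<open>c v1\<close> are \<open>sqrt q\<close> times the cosine and
  sine of the antiderivative of \<open>\<omega>\<close>.  Uniqueness needs no Lipschitz argument: for a third solution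
  \<open>v\<close>, the relation \<open>v W(v1, v2) = v2 W(v1, v) - v1 W(v2, v)\<close> and Abel's identity exhibit \<open>v\<close> as
  the expected combination of \<open>v1\<close> and \<open>v2\<close>.
\<close>

section \<open>Calculus on half-open intervals with a possibly infinite end point\<close>

lemma Ioo0_subset_Ico0: "Ioo0 T \<subseteq> Ico0 T"
  by (auto simp: Ioo0_def Ico0_def)

lemma Ico0_mono: "S \<le> T \<Longrightarrow> Ico0 S \<subseteq> Ico0 T"
  by (auto simp: Ico0_def)

lemma Ioo0_mono: "S \<le> T \<Longrightarrow> Ioo0 S \<subseteq> Ioo0 T"
  by (auto simp: Ioo0_def)

lemma zero_in_Ico0: "0 < T \<Longrightarrow> 0 \<in> Ico0 T"
  by (simp add: Ico0_def zero_ereal_def)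

lemma Ico0_closed_below: "t \<in> Ico0 T \<Longrightarrow> {0..t} \<subseteq> Ico0 T"
  by (auto simp: Ico0_def intro: le_less_trans[of _ "ereal t"])

lemma Ioo0_open_below: "t \<in> Ico0 T \<Longrightarrow> {0<..<t} \<subseteq> Ioo0 T"
  by (auto simp: Ico0_def Ioo0_def intro: less_trans[of _ "ereal t"])

lemma Ico0_cases:
  assumes "t \<in> Ico0 T"
  obtains "t = 0" | "t \<in> Ioo0 T"
  using assms by (force simp: Ico0_def Ioo0_def)

lemma Ioo0_pos_real:
  assumes "0 < T"
  obtains e where "0 < e" "ereal e < T"
  using ereal_dense2[OF assms] by (auto simp: zero_ereal_def)

lemma eventually_Ioo0:
  assumes "0 < T"
  shows "eventually (\<lambda>t. t \<in> Ioo0 T) (at_right 0)"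
proof -
  obtain e where e: "0 < e" "ereal e < T" using Ioo0_pos_real[OF assms] .
  show ?thesis
    unfolding eventually_at_right_field
    using e by (intro exI[of _ e]) (auto simp: Ioo0_def intro: less_trans[of _ "ereal e"])
qed

lemma at_within_Ico0:
  assumes "0 < T"
  shows "at 0 within Ico0 T = at_right 0"
proof -
  obtain e where e: "0 < e" "ereal e < T" using Ioo0_pos_real[OF assms] .
  show ?thesis
    by (rule at_within_nhd[where S = "{..<e}"])
      (use e in \<open>auto simp: Ico0_def intro: less_trans[of _ "ereal e"]\<close>)
qed

lemma continuous_on_Ico0_tendsto:
  fixes f :: "real \<Rightarrow> 'a::topological_space"
  assumes "continuous_on (Ico0 T) f" "0 < T"
  shows "(f \<longlongrightarrow> f 0) (at_right 0)"
  using assms(1) zero_in_Ico0[OF assms(2)]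
  by (auto simp: continuous_on_def at_within_Ico0[OF assms(2)])

lemma continuous_on_Ico0I:
  fixes f :: "real \<Rightarrow> 'a::topological_space"
  assumes "0 < T" "\<And>t. t \<in> Ioo0 T \<Longrightarrow> isCont f t" "(f \<longlongrightarrow> f 0) (at_right 0)"
  shows "continuous_on (Ico0 T) f"
  unfolding continuous_on_def
proof
  fix t assume "t \<in> Ico0 T"
  then show "(f \<longlongrightarrow> f t) (at t within Ico0 T)"
  proof (cases rule: Ico0_cases)
    case 1
    then show ?thesis using assms(3) by (simp add: at_within_Ico0[OF assms(1)])
  next
    case 2
    then show ?thesis
      using assms(2) by (metis UNIV_I subset_UNIV isCont_def tendsto_within_subset)
  qed
qed

text \<open>The derivative is required only inside the interval, continuity also at
  \<open>0\<close>: solutions are differentiable on the open interval and merely have one-sided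
  limits at \<open>0\<close>.\<close>

lemma FTC_Ico0:
  fixes f :: "real \<Rightarrow> 'a::banach"
  assumes "continuous_on (Ico0 T) f"
    and "\<And>t. t \<in> Ioo0 T \<Longrightarrow> (f has_vector_derivative f' t) (at t)"
    and "t \<in> Ico0 T"
  shows "(f' has_integral (f t - f 0)) {0..t}"
proof (rule fundamental_theorem_of_calculus_interior)
  show "0 \<le> t" using assms(3) by (simp add: Ico0_def)
  show "continuous_on {0..t} f"
    using assms(1) Ico0_closed_below[OF assms(3)] by (rule continuous_on_subset)
  show "(f has_vector_derivative f' x) (at x)" if "x \<in> {0<..<t}" for x
    using assms(2) Ioo0_open_below[OF assms(3)] that by blast
qed

lemma constant_on_Ico0:
  fixes f :: "real \<Rightarrow> 'a::banach"
  assumes "continuous_on (Ico0 T) f"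
    and "\<And>t. t \<in> Ioo0 T \<Longrightarrow> (f has_vector_derivative 0) (at t)"
    and "t \<in> Ico0 T"
  shows "f t = f 0"
  using FTC_Ico0[OF assms(1,2,3)] has_integral_0 has_integral_unique by (metis eq_iff_diff_eq_0)

lemma integral_has_vector_derivative_Ioo0:
  fixes g :: "real \<Rightarrow> 'a::banach"
  assumes "continuous_on (Ico0 T) g" "t \<in> Ioo0 T"
  shows "((\<lambda>t. integral {0..t} g) has_vector_derivative g t) (at t)"
proof -
  have t: "0 < t" "ereal t < T" using assms(2) by (auto simp: Ioo0_def)
  \<comment> \<open>Some \<open>s\<close> beyond \<open>t\<close> makes \<open>t\<close> interior to
    \<open>{0..s}\<close>, so the derivative within the compact interval becomes a two-sided
    one.\<close>
  obtain s where s: "t < s" "ereal s < T" using ereal_dense2[OF t(2)] by auto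
  then have "s \<in> Ico0 T" using t by (simp add: Ico0_def)
  then have "continuous_on {0..s} g"
    using assms(1) Ico0_closed_below continuous_on_subset by blast
  then have "((\<lambda>t. integral {0..t} g) has_vector_derivative g t) (at t within {0..s})"
    by (rule integral_has_vector_derivative) (use s t in auto)
  moreover have "at t within {0..s} = at t"
    by (rule at_within_interior) (use s t in auto)
  ultimately show ?thesis by simp
qed

lemma continuous_on_Ico0_integral:
  fixes g :: "real \<Rightarrow> 'a::banach"
  assumes "0 < T" "continuous_on (Ico0 T) g"
  shows "continuous_on (Ico0 T) (\<lambda>t. integral {0..t} g)"
proof (rule continuous_on_Ico0I[OF assms(1)])
  show "isCont (\<lambda>t. integral {0..t} g) t" if "t \<in> Ioo0 T" for t
    using integral_has_vector_derivative_Ioo0[OF assms(2) that]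
    by (rule has_vector_derivative_continuous)
  obtain e where e: "0 < e" "ereal e < T" using Ioo0_pos_real[OF assms(1)] .
  then have "continuous_on {0..e} g"
    using assms(2) Ico0_closed_below[of e T] continuous_on_subset
    by (auto simp: Ico0_def)
  then have "continuous_on {0..e} (\<lambda>t. integral {0..t} g)"
    by (intro indefinite_integral_continuous_1 integrable_continuous_real)
  then have "((\<lambda>t. integral {0..t} g) \<longlongrightarrow> integral {0..0} g) (at 0 within {0..e})"
    unfolding continuous_on_def using e(1) by (auto dest: bspec[where x = 0])
  then show "((\<lambda>t. integral {0..t} g) \<longlongrightarrow> integral {0..0} g) (at_right 0)"
    using e by (simp add: at_within_Icc_at_right)
qed

lemma continuous_on_Ico0_absolutely_integrable:
  fixes g :: "real \<Rightarrow> 'a::euclidean_space"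
  assumes "continuous_on (Ico0 T) g" "t \<in> Ico0 T"
  shows "g absolutely_integrable_on {0..t}"
  using assms Ico0_closed_below continuous_on_subset
  by (intro absolutely_integrable_continuous_real) blast

section \<open>Right-hand values at \<open>0\<close> and regularity of solutions\<close>

lemma right_val_0_eq:
  assumes "(f \<longlongrightarrow> l) (at_right (0::real))"
  shows "right_val f 0 = l"
  using assms by (simp add: right_val_def tendsto_Lim)

lemma dt_eq_vector_derivative: "t \<noteq> 0 \<Longrightarrow> dt f t = vector_derivative f (at t)"
  by (simp add: dt_def right_val_def)

lemma tendsto_right_val_iff:
  "(right_val f \<longlongrightarrow> l) (at_right (0::real)) \<longleftrightarrow> (f \<longlongrightarrow> l) (at_right 0)"
  by (rule filterlim_cong) (auto simp: right_val_def eventually_at_filter)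

lemma ivp_solution_mono:
  assumes "ivp_solution T a b x0 x1 v" "S \<le> T"
  shows "ivp_solution S a b x0 x1 v"
  using assms Ioo0_mono by (fastforce simp: ivp_solution_def)

context
  fixes T a b x0 x1 v
  assumes sol: "ivp_solution T a b x0 x1 v" and T: "0 < T"
begin

lemma ivp_solution_has_derivative:
  assumes "t \<in> Ioo0 T"
  shows "(v has_real_derivative dt v t) (at t)"
proof -
  have "v differentiable (at t)" "t \<noteq> 0"
    using sol assms by (auto simp: ivp_solution_def Ioo0_def)
  then show ?thesis
    by (simp add: dt_eq_vector_derivative has_real_derivative_iff_has_vector_derivative
        vector_derivative_works)
qed

lemma ivp_solution_dt_has_derivative:
  assumes "t \<in> Ioo0 T"
  shows "(dt v has_real_derivative - (a t * dt v t + b t * v t)) (at t)"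
proof -
  have "dt v differentiable (at t)" "t \<noteq> 0" "dt (dt v) t + a t * dt v t + b t * v t = 0"
    using sol assms by (auto simp: ivp_solution_def Ioo0_def)
  moreover from this have "dt (dt v) t = - (a t * dt v t + b t * v t)" by linarith
  ultimately show ?thesis
    by (metis dt_eq_vector_derivative has_real_derivative_iff_has_vector_derivative
        vector_derivative_works)
qed

lemma ivp_solution_0: "v 0 = x0"
  using sol by (simp add: ivp_solution_def)

text \<open>\<open>dt v 0\<close> is a \<open>Lim\<close>, which says nothing by itself; the
  convergence demanded by \<open>ivp_solution\<close> makes it the prescribed slope.\<close>

lemma ivp_solution_dt_0: "dt v 0 = x1"
  using sol by (simp add: ivp_solution_def dt_def tendsto_right_val_iff right_val_0_eq)

lemma ivp_solution_continuous: "continuous_on (Ico0 T) v"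
proof (rule continuous_on_Ico0I[OF T])
  show "isCont v t" if "t \<in> Ioo0 T" for t
    using ivp_solution_has_derivative[OF that] by (rule DERIV_isCont)
  show "(v \<longlongrightarrow> v 0) (at_right 0)" using sol by (simp add: ivp_solution_def)
qed

lemma ivp_solution_dt_continuous: "continuous_on (Ico0 T) (dt v)"
proof (rule continuous_on_Ico0I[OF T])
  show "isCont (dt v) t" if "t \<in> Ioo0 T" for t
    using ivp_solution_dt_has_derivative[OF that] by (rule DERIV_isCont)
  show "(dt v \<longlongrightarrow> dt v 0) (at_right 0)"
    unfolding ivp_solution_dt_0 using sol by (simp add: ivp_solution_def)
qed

end

lemma ivp_solutionI:
  fixes p :: "real \<Rightarrow> real"
  assumes T: "0 < T"
    and v: "\<And>t. t \<in> Ioo0 T \<Longrightarrow> (v has_real_derivative p t) (at t)"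
    and p: "\<And>t. t \<in> Ioo0 T \<Longrightarrow> (p has_real_derivative - (a t * p t + b t * v t)) (at t)"
    and v0: "v 0 = x0" "continuous_on (Ico0 T) v"
    and p0: "p 0 = x1" "continuous_on (Ico0 T) p"
  shows "ivp_solution T a b x0 x1 v"
proof -
  have dt: "dt v t = p t" if "t \<in> Ioo0 T" for t
    using v[OF that] that
    by (simp add: dt_eq_vector_derivative Ioo0_def has_real_derivative_iff_has_vector_derivative
        vector_derivative_at)
  \<comment> \<open>\<open>dt v\<close> is known to agree with \<open>p\<close> only on
    \<open>Ioo0 T\<close>; openness lets the derivative of \<open>p\<close> pass to
    \<open>dt v\<close>.\<close>
  have "open (Ioo0 T)"
  proof -
    have "Ioo0 T = {0<..} \<inter> ereal -` {..<T}" by (auto simp: Ioo0_def)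
    then show ?thesis
      by (simp add: open_Int open_vimage continuous_on_ereal)
  qed
  have dp: "(dt v has_real_derivative - (a t * p t + b t * v t)) (at t)" if "t \<in> Ioo0 T" for t
    using p[OF that] \<open>open (Ioo0 T)\<close> that
    by (rule has_field_derivative_transform_within_open) (simp add: dt)
  have "dt (dt v) t = - (a t * p t + b t * v t)" if "t \<in> Ioo0 T" for t
    using dp[OF that] that
    by (simp add: dt_eq_vector_derivative Ioo0_def has_real_derivative_iff_has_vector_derivative
        vector_derivative_at)
  moreover have "(dt v \<longlongrightarrow> x1) (at_right 0)"
    using continuous_on_Ico0_tendsto[OF p0(2) T] unfolding p0(1)
    by (rule Lim_transform_eventually)
      (use eventually_Ioo0[OF T] dt in \<open>auto elim: eventually_mono\<close>)
  moreover have "(v \<longlongrightarrow> x0) (at_right 0)"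
    using continuous_on_Ico0_tendsto[OF v0(2) T] unfolding v0(1) .
  ultimately show ?thesis
    unfolding ivp_solution_def using v0(1) v dp dt
    by (simp add: real_differentiable_def) blast
qed

section \<open>Abel's identity and the two-dimensional solution space\<close>

lemma abel_identity:
  assumes f: "ivp_solution T a b x0 x1 f" and g: "ivp_solution T a b y0 y1 g"
    and T: "0 < T" and a: "continuous_on (Ico0 T) a" and t: "t \<in> Ico0 T"
  shows "wronskian f g t = (x1 * y0 - x0 * y1) * exp (- integral {0..t} a)"
proof -
  \<comment> \<open>The exponential is an integrating factor for \<open>W' = - a W\<close>, so
    \<open>F\<close> has derivative zero.\<close>
  define F where "F t = wronskian f g t * exp (integral {0..t} a)" for t
  have "F t = F 0"
  proof (rule constant_on_Ico0[OF _ _ t])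
    show "continuous_on (Ico0 T) F"
      unfolding F_def wronskian_def
      by (intro continuous_intros ivp_solution_continuous[OF f T] ivp_solution_continuous[OF g T]
          ivp_solution_dt_continuous[OF f T] ivp_solution_dt_continuous[OF g T]
          continuous_on_Ico0_integral[OF T a])
    fix s assume s: "s \<in> Ioo0 T"
    note [derivative_intros] = ivp_solution_has_derivative[OF f T s]
      ivp_solution_has_derivative[OF g T s] ivp_solution_dt_has_derivative[OF f T s]
      ivp_solution_dt_has_derivative[OF g T s]
      integral_has_vector_derivative_Ioo0[OF a s,
        folded has_real_derivative_iff_has_vector_derivative]
    have "(F has_real_derivative 0) (at s)"
      unfolding F_def wronskian_def
      by (auto intro!: derivative_eq_intros simp: algebra_simps)
    then show "(F has_vector_derivative 0) (at s)"
      by (simp add: has_real_derivative_iff_has_vector_derivative)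
  qed
  then have "wronskian f g t * exp (integral {0..t} a) = x1 * y0 - x0 * y1"
    by (simp add: F_def wronskian_def ivp_solution_0[OF f T] ivp_solution_0[OF g T]
        ivp_solution_dt_0[OF f T] ivp_solution_dt_0[OF g T])
  then show ?thesis by (simp add: exp_minus divide_simps)
qed

lemma ivp_solution_eq_combination:
  assumes v1: "ivp_solution T a b 0 1 v1" and v2: "ivp_solution T a b x0 x1 v2"
    and v: "ivp_solution T a b y0 y1 v" and "x0 \<noteq> 0"
    and T: "0 < T" and a: "continuous_on (Ico0 T) a" and t: "t \<in> Ico0 T"
  shows "v t = y0 / x0 * v2 t + (y1 - y0 * x1 / x0) * v1 t"
proof -
  let ?E = "exp (- integral {0..t} a)"
  have W: "wronskian v1 v2 t = x0 * ?E" "wronskian v1 v t = y0 * ?E"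
      "wronskian v2 v t = (x1 * y0 - x0 * y1) * ?E"
    using abel_identity[OF v1 v2 T a t] abel_identity[OF v1 v T a t] abel_identity[OF v2 v T a t]
    by auto
  \<comment> \<open>Expansion of a vanishing 3x3 determinant: the row \<open>(v1, v2, v)\<close>
    twice above \<open>(dt v1, dt v2, dt v)\<close>. By Abel's identity all three Wronskians are
    constants times the same positive exponential, which cancels.\<close>
  have "v t * wronskian v1 v2 t = v2 t * wronskian v1 v t - v1 t * wronskian v2 v t"
    by (simp add: wronskian_def algebra_simps)
  then have "?E * (v t * x0) = ?E * (v2 t * y0 - v1 t * (x1 * y0 - x0 * y1))"
    unfolding W by (simp add: algebra_simps)
  then have "v t * x0 = v2 t * y0 - v1 t * (x1 * y0 - x0 * y1)" by simp
  then show ?thesis using \<open>x0 \<noteq> 0\<close> by (simp add: field_simps)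
qed

lemma ivp_solution_combination:
  assumes f: "ivp_solution T a b x0 x1 f" and g: "ivp_solution T a b y0 y1 g" and T: "0 < T"
  shows "ivp_solution T a b (k * x0 + l * y0) (k * x1 + l * y1) (\<lambda>t. k * f t + l * g t)"
proof (rule ivp_solutionI[OF T, where p = "\<lambda>t. k * dt f t + l * dt g t"])
  fix s assume s: "s \<in> Ioo0 T"
  note [derivative_intros] = ivp_solution_has_derivative[OF f T s]
    ivp_solution_has_derivative[OF g T s] ivp_solution_dt_has_derivative[OF f T s]
    ivp_solution_dt_has_derivative[OF g T s]
  show "((\<lambda>t. k * f t + l * g t) has_real_derivative k * dt f s + l * dt g s) (at s)"
    by (auto intro!: derivative_eq_intros)
  show "((\<lambda>t. k * dt f t + l * dt g t) has_real_derivative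
      - (a s * (k * dt f s + l * dt g s) + b s * (k * f s + l * g s))) (at s)"
    by (auto intro!: derivative_eq_intros simp: algebra_simps)
qed (auto simp: ivp_solution_0[OF f T] ivp_solution_0[OF g T]
        ivp_solution_dt_0[OF f T] ivp_solution_dt_0[OF g T]
      intro!: continuous_intros ivp_solution_continuous[OF f T] ivp_solution_continuous[OF g T]
        ivp_solution_dt_continuous[OF f T] ivp_solution_dt_continuous[OF g T])


section \<open>The squared amplitude, its logarithmic derivative and the frequency\<close>

locale amplitude_phase =
  fixes T :: ereal and a b v1 v2 :: "real \<Rightarrow> real" and \<omega>0 \<omega>1 \<sigma> :: real and c :: complex
  assumes T: "0 < T"
    and a: "continuous_on (Ico0 T) a" and b: "continuous_on (Ico0 T) b"
    and \<omega>0: "0 < \<omega>0"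
    and v1: "ivp_solution T a b 0 1 v1"
    and v2: "ivp_solution T a b (1 / \<omega>0) (- (1 / \<omega>0) * (a 0 / 2 + \<omega>1 / (2 * \<omega>0))) v2"
    and c_square: "c\<^sup>2 = of_real \<sigma>" and c_nonzero: "c \<noteq> 0"
    and c_axis: "Im c = 0 \<or> Re c = 0"
    and q_pos: "\<And>t. t \<in> Ico0 T \<Longrightarrow> 0 < \<sigma> * (v1 t)\<^sup>2 + (v2 t)\<^sup>2"
begin

text \<open>Positivity of this squared amplitude is a locale assumption because its source differs:
  for \<open>\<sigma> = 1\<close> it comes from the nonzero Wronskian, for
  \<open>\<sigma> = -1\<close> it restricts the interval.\<close>

definition q where "q t = \<sigma> * (v1 t)\<^sup>2 + (v2 t)\<^sup>2"

text \<open>\<open>g\<close> is \<open>q' / (2 q)\<close>, so that \<open>\<alpha> = - g\<close>, and \<open>h\<close> is \<open>\<omega>' / (2 \<omega>)\<close>.\<close>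

definition g where "g t = (\<sigma> * v1 t * dt v1 t + v2 t * dt v2 t) / q t"

definition h where "h t = - (a t / 2) - g t"

definition r where "r t = wronskian v1 v2 t / q t"

definition \<omega> :: "real \<Rightarrow> complex" where "\<omega> t = c * of_real (r t)"

lemma q_pos': "t \<in> Ico0 T \<Longrightarrow> 0 < q t"
  using q_pos by (simp add: q_def)

lemma q_nonzero: "t \<in> Ico0 T \<Longrightarrow> q t \<noteq> 0"
  using q_pos' by fastforce

lemmas v_continuous =
  ivp_solution_continuous[OF v1 T] ivp_solution_dt_continuous[OF v1 T]
  ivp_solution_continuous[OF v2 T] ivp_solution_dt_continuous[OF v2 T]

lemmas v_derivs =
  ivp_solution_has_derivative[OF v1 T] ivp_solution_dt_has_derivative[OF v1 T]
  ivp_solution_has_derivative[OF v2 T] ivp_solution_dt_has_derivative[OF v2 T]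

lemmas v_init =
  ivp_solution_0[OF v1 T] ivp_solution_dt_0[OF v1 T]
  ivp_solution_0[OF v2 T] ivp_solution_dt_0[OF v2 T]

lemma q_continuous: "continuous_on (Ico0 T) q"
  unfolding q_def by (intro continuous_intros v_continuous)

lemma g_continuous: "continuous_on (Ico0 T) g"
  unfolding g_def by (intro continuous_intros v_continuous q_continuous) (auto dest: q_nonzero)

lemma h_continuous: "continuous_on (Ico0 T) h"
  unfolding h_def by (intro continuous_intros a g_continuous) auto

lemma r_continuous: "continuous_on (Ico0 T) r"
  unfolding r_def wronskian_def
  by (intro continuous_intros v_continuous q_continuous) (auto dest: q_nonzero)

lemma \<omega>_continuous: "continuous_on (Ico0 T) \<omega>"
  unfolding \<omega>_def by (intro continuous_intros r_continuous)

lemma q_0: "q 0 = 1 / \<omega>0\<^sup>2"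
  by (simp add: q_def v_init power_divide)

lemma r_0: "r 0 = \<omega>0"
  using \<omega>0 by (simp add: r_def wronskian_def v_init q_0 power2_eq_square)

text \<open>The initial slope of \<open>v2\<close> is designed for this value: since
  \<open>v1 0 = 0\<close>, \<open>g 0\<close> is the logarithmic derivative of \<open>v2\<close> at
  \<open>0\<close>, namely \<open>- (a 0 / 2 + \<omega>1 / (2 * \<omega>0))\<close>.\<close>

lemma h_0: "h 0 = \<omega>1 / (2 * \<omega>0)"
  using \<omega>0 by (simp add: h_def g_def v_init q_0 field_simps power2_eq_square)

text \<open>By Abel's identity the Wronskian is \<open>1 / \<omega>0\<close> times an
  exponential.\<close>

lemma r_nonzero:
  assumes "t \<in> Ico0 T"
  shows "r t \<noteq> 0"
  using abel_identity[OF v1 v2 T a assms] q_nonzero[OF assms] \<omega>0 by (simp add: r_def)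

lemma \<omega>_nonzero: "t \<in> Ico0 T \<Longrightarrow> \<omega> t \<noteq> 0"
  by (simp add: \<omega>_def c_nonzero r_nonzero)

context
  fixes t assumes t: "t \<in> Ioo0 T"
begin

lemma q_nonzero_interior: "q t \<noteq> 0"
  using q_nonzero t Ioo0_subset_Ico0 by blast

lemma q_has_derivative: "(q has_real_derivative 2 * g t * q t) (at t)"
proof -
  note [derivative_intros] = v_derivs[OF t]
  have "(q has_real_derivative 2 * (\<sigma> * v1 t * dt v1 t + v2 t * dt v2 t)) (at t)"
    unfolding q_def by (auto intro!: derivative_eq_intros simp: algebra_simps)
  then show ?thesis using q_nonzero_interior by (simp add: g_def)
qed

lemma wronskian_has_derivative:
  "(wronskian v1 v2 has_real_derivative - a t * wronskian v1 v2 t) (at t)"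
proof -
  note [derivative_intros] = v_derivs[OF t]
  have "((\<lambda>t. dt v1 t * v2 t - v1 t * dt v2 t) has_real_derivative - a t * wronskian v1 v2 t) (at t)"
    unfolding wronskian_def by (auto intro!: derivative_eq_intros simp: algebra_simps)
  then show ?thesis by (simp add: wronskian_def[abs_def])
qed

text \<open>Logarithmic differentiation:
  \<open>r' / r = W' / W - q' / q = - a - 2 * g = 2 * h\<close>.\<close>

lemma r_has_derivative: "(r has_real_derivative 2 * r t * h t) (at t)"
proof -
  note [derivative_intros] = q_has_derivative wronskian_has_derivative
  show ?thesis
    unfolding r_def using q_nonzero_interior
    by (auto intro!: derivative_eq_intros simp: h_def field_simps power2_eq_square)
qed

text \<open>A Riccati equation. Differentiating the quotient and inserting the differential equation
  gives \<open>g' = P / q - a * g - b - 2 * g\<^sup>2\<close>, where \<open>P\<close> collects the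
  squares of the derivatives. Once \<open>P / q\<close> is written as
  \<open>\<sigma> * r\<^sup>2 + g\<^sup>2\<close>, completing the square with
  \<open>h = - (a / 2 + g)\<close> yields the stated form.\<close>

lemma g_has_derivative:
  "(g has_real_derivative \<sigma> * (r t)\<^sup>2 - (b t - (a t / 2)\<^sup>2 + (h t)\<^sup>2)) (at t)"
proof -
  note [derivative_intros] = q_has_derivative v_derivs[OF t]
  define Q N where "Q = q t" and "N = \<sigma> * v1 t * dt v1 t + v2 t * dt v2 t"
  have Q: "Q \<noteq> 0" using q_nonzero_interior by (simp add: Q_def)
  have gN: "g t = N / Q" by (simp add: g_def Q_def N_def)
  define P where "P = \<sigma> * (dt v1 t)\<^sup>2 + (dt v2 t)\<^sup>2"
  have "(g has_real_derivative ((P - a t * N - b t * Q) * Q - N * (2 * N)) / Q\<^sup>2) (at t)"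
    unfolding g_def
  proof (rule DERIV_cong[OF DERIV_divide])
    show "((\<lambda>t. \<sigma> * v1 t * dt v1 t + v2 t * dt v2 t) has_real_derivative
        P - a t * N - b t * Q) (at t)"
      unfolding N_def Q_def P_def q_def
      by (auto intro!: derivative_eq_intros simp: algebra_simps power2_eq_square)
    show "(q has_real_derivative 2 * N) (at t)"
      using q_has_derivative Q gN by (simp add: Q_def)
  qed (use Q in \<open>auto simp: Q_def N_def power2_eq_square\<close>)
  moreover have "((P - a t * N - b t * Q) * Q - N * (2 * N)) / Q\<^sup>2
      = \<sigma> * (r t)\<^sup>2 - (b t - (a t / 2)\<^sup>2 + (h t)\<^sup>2)"
  proof -
    \<comment> \<open>Lagrange's identity for the quadratic form with weights
      \<open>\<sigma>\<close> and \<open>1\<close>, applied to \<open>(v1, v2)\<close> and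
      \<open>(dt v1, dt v2)\<close>.\<close>
    have "P * Q - N\<^sup>2 = \<sigma> * (wronskian v1 v2 t)\<^sup>2"
      unfolding Q_def N_def P_def q_def wronskian_def by (simp add: algebra_simps power2_eq_square)
    then have "\<sigma> * (r t)\<^sup>2 = (P * Q - N\<^sup>2) / Q\<^sup>2"
      by (simp add: r_def Q_def power_divide)
    also have "\<dots> = P / Q - (g t)\<^sup>2"
      using Q by (simp add: gN field_simps power2_eq_square)
    finally have "\<sigma> * (r t)\<^sup>2 = P / Q - (g t)\<^sup>2" .
    moreover have "((P - a t * N - b t * Q) * Q - N * (2 * N)) / Q\<^sup>2
        = P / Q - a t * g t - b t - 2 * (g t)\<^sup>2"
      using Q by (simp add: gN field_simps power2_eq_square)
    ultimately show ?thesis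
      by (simp add: h_def power2_eq_square algebra_simps)
  qed
  ultimately show ?thesis by simp
qed

lemma \<omega>_has_vector_derivative: "(\<omega> has_vector_derivative \<omega> t * of_real (2 * h t)) (at t)"
proof -
  have "(\<omega> has_vector_derivative c * of_real (2 * r t * h t)) (at t)"
    unfolding \<omega>_def by (intro derivative_intros r_has_derivative)
  then show ?thesis by (simp add: \<omega>_def mult_ac)
qed

lemma \<omega>_logderiv: "vector_derivative \<omega> (at t) / (2 * \<omega> t) = of_real (h t)"
  using vector_derivative_at[OF \<omega>_has_vector_derivative] \<omega>_nonzero t Ioo0_subset_Ico0[of T]
  by auto

end

section \<open>The frequency function property and the initial values\<close>

lemma half_logderiv_\<omega>:
  assumes "t \<in> Ico0 T"
  shows "half_logderiv \<omega> t = of_real (h t)"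
  using assms
proof (cases rule: Ico0_cases)
  case 1
  \<comment> \<open>At \<open>0\<close> the value is a limit of
    \<open>\<omega>' / (2 * \<omega>)\<close>, and continuity of \<open>h\<close> supplies
    it.\<close>
  have "((\<lambda>t. of_real (h t) :: complex) \<longlongrightarrow> of_real (h 0)) (at_right 0)"
    by (intro tendsto_intros continuous_on_Ico0_tendsto[OF h_continuous T])
  then have "((\<lambda>t. vector_derivative \<omega> (at t) / (2 * \<omega> t)) \<longlongrightarrow> of_real (h 0)) (at_right 0)"
    by (rule Lim_transform_eventually)
      (use eventually_Ioo0[OF T] in eventually_elim, simp add: \<omega>_logderiv)
  then show ?thesis unfolding 1 half_logderiv_def by (rule right_val_0_eq)
next
  case 2
  then show ?thesis
    using \<omega>_logderiv by (simp add: half_logderiv_def right_val_def Ioo0_def)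
qed

lemma half_logderiv_\<omega>_continuous: "continuous_on (Ico0 T) (half_logderiv \<omega>)"
proof -
  have "continuous_on (Ico0 T) (\<lambda>t. of_real (h t) :: complex)"
    by (intro continuous_intros h_continuous)
  then show ?thesis by (rule continuous_on_eq) (simp add: half_logderiv_\<omega>)
qed

lemma \<omega>_0: "\<omega> 0 = c * of_real \<omega>0"
  by (simp add: \<omega>_def r_0)

text \<open>In the interior \<open>\<omega>' = 2 * h * \<omega>\<close>, and both factors are
  continuous up to \<open>0\<close> with known values there.\<close>

lemma dt_\<omega>_tendsto: "(dt \<omega> \<longlongrightarrow> c * of_real \<omega>1) (at_right 0)"
proof -
  have "((\<lambda>t. \<omega> t * of_real (2 * h t)) \<longlongrightarrow> \<omega> 0 * of_real (2 * h 0)) (at_right 0)"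
    (is "(?f \<longlongrightarrow> ?l) _")
    by (intro tendsto_intros continuous_on_Ico0_tendsto[OF h_continuous T]
        continuous_on_Ico0_tendsto[OF \<omega>_continuous T])
  moreover have "?l = c * of_real \<omega>1"
    using \<omega>0 by (simp add: \<omega>_0 h_0)
  ultimately have lim: "(?f \<longlongrightarrow> c * of_real \<omega>1) (at_right 0)" by (simp only:)
  have "eventually (\<lambda>t. ?f t = dt \<omega> t) (at_right 0)"
    using eventually_Ioo0[OF T]
  proof eventually_elim
    case (elim t)
    then show ?case
      using vector_derivative_at[OF \<omega>_has_vector_derivative[OF elim]]
      by (simp add: dt_eq_vector_derivative Ioo0_def)
  qed
  with lim show ?thesis by (rule Lim_transform_eventually)
qed

lemma frequency_function_\<omega>: "frequency_function T a b \<omega>"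
  unfolding frequency_function_def
proof (intro conjI ballI)
  fix t assume t: "t \<in> Ioo0 T"
  then have t': "t \<in> Ico0 T" using Ioo0_subset_Ico0 by blast
  show "\<omega> differentiable (at t)"
    using \<omega>_has_vector_derivative[OF t] by (rule differentiableI_vector)
  show "\<omega> t \<noteq> 0" using \<omega>_nonzero[OF t'] .
  show "Im (\<omega> t) = 0 \<or> Re (\<omega> t) = 0" using c_axis by (auto simp: \<omega>_def)
  let ?F = "\<lambda>s. of_real (b s - (a s / 2)\<^sup>2) + (half_logderiv \<omega> s)\<^sup>2"
  show int_\<omega>: "(\<lambda>s. (\<omega> s)\<^sup>2) absolutely_integrable_on {0..t}"
    by (intro continuous_on_Ico0_absolutely_integrable[OF _ t'] continuous_intros \<omega>_continuous)
  show int_F: "?F absolutely_integrable_on {0..t}"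
    by (intro continuous_on_Ico0_absolutely_integrable[OF _ t'] continuous_intros a b
        half_logderiv_\<omega>_continuous) auto
  \<comment> \<open>Integrates the Riccati equation. Since \<open>g = - a / 2 - h\<close>, the
    increment of \<open>g\<close> is exactly the boundary part of the defining identity.\<close>
  have "((\<lambda>s. of_real (\<sigma> * (r s)\<^sup>2 - (b s - (a s / 2)\<^sup>2 + (h s)\<^sup>2)))
      has_integral (of_real (g t) - of_real (g 0) :: complex)) {0..t}"
    by (rule FTC_Ico0[OF continuous_on_of_real[OF g_continuous]
          has_vector_derivative_of_real[OF g_has_derivative] t'])
  moreover have "of_real (\<sigma> * (r s)\<^sup>2 - (b s - (a s / 2)\<^sup>2 + (h s)\<^sup>2)) = (\<omega> s)\<^sup>2 - ?F s"
    if "s \<in> {0..t}" for s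
    using half_logderiv_\<omega>[of s] Ico0_closed_below[OF t'] that
    by (auto simp: \<omega>_def power_mult_distrib c_square)
  ultimately have "((\<lambda>s. (\<omega> s)\<^sup>2 - ?F s) has_integral (of_real (g t) - of_real (g 0))) {0..t}"
    by (subst has_integral_cong[symmetric]) auto
  moreover have "integral {0..t} (\<lambda>s. (\<omega> s)\<^sup>2 - ?F s)
      = integral {0..t} (\<lambda>s. (\<omega> s)\<^sup>2) - integral {0..t} ?F"
    by (rule Henstock_Kurzweil_Integration.integral_diff)
      (rule set_lebesgue_integral_eq_integral(1), rule int_\<omega> int_F)+
  ultimately have "integral {0..t} (\<lambda>s. (\<omega> s)\<^sup>2) - integral {0..t} ?F
      = of_real (g t) - of_real (g 0)"
    by (simp only: integral_unique)
  then show "integral {0..t} (\<lambda>s. (\<omega> s)\<^sup>2) = integral {0..t} ?F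
      - of_real (a t / 2) + of_real (a 0 / 2) - half_logderiv \<omega> t + half_logderiv \<omega> 0"
    by (simp add: half_logderiv_\<omega>[OF t'] half_logderiv_\<omega>[OF zero_in_Ico0[OF T]] h_def
        algebra_simps)
next
  show "(\<omega> \<longlongrightarrow> \<omega> 0) (at_right 0)"
    by (rule continuous_on_Ico0_tendsto[OF \<omega>_continuous T])
  show "(half_logderiv \<omega> \<longlongrightarrow> half_logderiv \<omega> 0) (at_right 0)"
    by (rule continuous_on_Ico0_tendsto[OF half_logderiv_\<omega>_continuous T])
qed

section \<open>The solution formula: amplitude, phase and coefficients\<close>

lemma alpha_\<omega>: "t \<in> Ico0 T \<Longrightarrow> alpha a \<omega> t = - of_real (g t)"
  by (simp add: alpha_def half_logderiv_\<omega> h_def)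

lemma alpha_\<omega>_continuous: "continuous_on (Ico0 T) (alpha a \<omega>)"
proof -
  have "continuous_on (Ico0 T) (\<lambda>t. - of_real (g t) :: complex)"
    by (intro continuous_intros g_continuous)
  then show ?thesis by (rule continuous_on_eq) (simp add: alpha_\<omega>)
qed

text \<open>\<open>- q' / (2 * q)\<close> has the antiderivative \<open>- ln q / 2\<close>.
  Normalised at \<open>0\<close>, the exponential becomes \<open>sqrt (q t / q 0)\<close>, and
  \<open>q 0 = 1 / \<omega>0\<^sup>2\<close> explains the factor \<open>\<omega>0\<close>.\<close>

lemma rho_\<omega>:
  assumes t: "t \<in> Ico0 T"
  shows "rho a \<omega> t = of_real (\<omega>0 * sqrt (q t))"
proof -
  have "((\<lambda>s. - of_real (g s))
      has_integral (of_real (- ln (q t) / 2) - of_real (- ln (q 0) / 2) :: complex)) {0..t}"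
  proof (rule FTC_Ico0[OF _ _ t])
    show "continuous_on (Ico0 T) (\<lambda>t. of_real (- ln (q t) / 2) :: complex)"
      by (intro continuous_intros q_continuous) (auto dest: q_nonzero)
    fix s assume s: "s \<in> Ioo0 T"
    then have "0 < q s" using q_pos' Ioo0_subset_Ico0 by blast
    note [derivative_intros] = q_has_derivative[OF s]
    have "((\<lambda>t. - ln (q t) / 2) has_real_derivative - g s) (at s)"
      using \<open>0 < q s\<close> by (auto intro!: derivative_eq_intros)
    from has_vector_derivative_of_real[OF this, where 'a = complex]
    show "((\<lambda>t. of_real (- ln (q t) / 2) :: complex) has_vector_derivative - of_real (g s)) (at s)"
      by simp
  qed
  then have "(alpha a \<omega> has_integral
      (of_real (- ln (q t) / 2) - of_real (- ln (q 0) / 2))) {0..t}"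
    by (rule has_integral_eq[rotated]) (use alpha_\<omega> Ico0_closed_below[OF t] in auto)
  then have "antideriv0 (alpha a \<omega>) t = of_real (- (ln (q t) / 2 - ln (q 0) / 2))"
    by (simp add: antideriv0_def integral_unique)
  then have "exp (- antideriv0 (alpha a \<omega>) t) = of_real (exp (ln (q t) / 2 - ln (q 0) / 2))"
    by (simp only: of_real_minus minus_minus exp_of_real)
  also have "exp (ln (q t) / 2 - ln (q 0) / 2) = \<omega>0 * sqrt (q t)"
  proof -
    have "exp (ln x / 2) = sqrt x" if "0 < x" for x :: real
      using that by (simp add: ln_sqrt[symmetric])
    then show ?thesis
      using q_pos'[OF t] q_pos'[OF zero_in_Ico0[OF T]] \<omega>0
      by (simp add: exp_diff q_0 real_sqrt_divide)
  qed
  finally show ?thesis using t by (simp add: rho_def heaviside_def Ico0_def)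
qed

text \<open>
  The polar form of the pair \<open>(v2, c v1)\<close>: since \<open>k\<^sup>2 = - \<sigma>\<close>, the amplitude factors as
  \<open>q = (v2 + k v1) (v2 - k v1)\<close>, and the difference of the logarithmic derivatives of the two
  factors is \<open>2 k W / q\<close> for the Wronskian \<open>W\<close>.
\<close>

lemma polar_form:
  fixes j :: complex
  assumes j: "j\<^sup>2 = - 1" and t: "t \<in> Ico0 T"
  shows "exp (j * antideriv0 \<omega> t) * of_real (sqrt (q t)) = of_real (v2 t) + j * c * of_real (v1 t)"
proof -
  define k where "k = j * c"
  have k: "k * k = - of_real \<sigma>"
    using j c_square by (simp add: k_def power2_eq_square algebra_simps)
  define \<Theta> where "\<Theta> = antideriv0 \<omega>"
  define Z where "Z t = (of_real (v2 t) + k * of_real (v1 t) :: complex)" for t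
  \<comment> \<open>The quotient of \<open>Z t / sqrt (q t)\<close> by the expected exponential.
    Showing that it is constant avoids branches of the complex logarithm.\<close>
  define F where "F t = exp (- (j * \<Theta> t)) * (Z t * of_real (1 / sqrt (q t)))" for t
  have "F t = F 0"
  proof (rule constant_on_Ico0[OF _ _ t])
    show "continuous_on (Ico0 T) F"
      unfolding F_def Z_def \<Theta>_def antideriv0_def
      by (intro continuous_intros v_continuous q_continuous continuous_on_Ico0_integral[OF T]
          \<omega>_continuous) (auto dest: q_nonzero)
    fix s assume s: "s \<in> Ioo0 T"
    then have s': "s \<in> Ico0 T" using Ioo0_subset_Ico0 by blast
    let ?Z' = "of_real (dt v2 s) + k * of_real (dt v1 s) :: complex"
    have "((\<lambda>t. - (j * \<Theta> t)) has_vector_derivative - (j * \<omega> s)) (at s)"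
      unfolding \<Theta>_def antideriv0_def
      by (intro derivative_intros integral_has_vector_derivative_Ioo0[OF \<omega>_continuous s])
    from field_vector_diff_chain_at[OF this DERIV_exp]
    have E: "((\<lambda>t. exp (- (j * \<Theta> t))) has_vector_derivative
        - (j * \<omega> s) * exp (- (j * \<Theta> s))) (at s)"
      by (simp add: o_def)
    have Z: "(Z has_vector_derivative ?Z') (at s)"
      unfolding Z_def by (intro derivative_intros v_derivs s)
    note [derivative_intros] = q_has_derivative[OF s]
    have "((\<lambda>t. 1 / sqrt (q t)) has_real_derivative - g s * (1 / sqrt (q s))) (at s)"
      using q_pos'[OF s'] by (auto intro!: derivative_eq_intros simp: field_simps)
    note R = has_vector_derivative_of_real[OF this, where 'a = complex]
    \<comment> \<open>This is \<open>Z' = (k * r + g) * Z\<close>, multiplied by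
      \<open>q = Z * ?Y\<close> to clear denominators. In the derivative of \<open>F\<close>, the
      term \<open>k * r = j * \<omega>\<close> cancels against the exponential and \<open>g\<close>
      against \<open>1 / sqrt q\<close>.\<close>
    have "of_real (q s) * (?Z' - k * of_real (r s) * Z s - of_real (g s) * Z s) = 0"
    proof -
      let ?Y = "of_real (v2 s) - k * of_real (v1 s) :: complex"
        and ?W = "of_real (wronskian v1 v2 s) :: complex"
        and ?G = "of_real (\<sigma> * v1 s * dt v1 s + v2 s * dt v2 s) :: complex"
      have "Z s * ?Y = of_real (v2 s * v2 s) - (k * k) * of_real (v1 s * v1 s)"
        by (simp add: Z_def algebra_simps)
      then have qZ: "of_real (q s) = Z s * ?Y"
        unfolding k by (simp add: q_def power2_eq_square)
      have "?Y * ?Z' = k * ?W + of_real (v2 s * dt v2 s) - (k * k) * of_real (v1 s * dt v1 s)"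
        by (simp add: wronskian_def algebra_simps)
      then have YZ': "?Y * ?Z' = k * ?W + ?G"
        unfolding k by simp
      have qr: "of_real (q s) * of_real (r s) = ?W" and qg: "of_real (q s) * of_real (g s) = ?G"
        using q_nonzero[OF s'] by (simp_all add: r_def g_def)
      have "of_real (q s) * (?Z' - k * of_real (r s) * Z s - of_real (g s) * Z s)
          = of_real (q s) * ?Z' - k * (of_real (q s) * of_real (r s)) * Z s
            - (of_real (q s) * of_real (g s)) * Z s"
        by (simp only: right_diff_distrib mult_ac)
      also have "\<dots> = Z s * (?Y * ?Z') - k * ?W * Z s - ?G * Z s"
        unfolding qr qg unfolding qZ by (simp only: mult_ac)
      also have "\<dots> = 0"
        unfolding YZ' by (simp only: distrib_left mult_ac) simp
      finally show ?thesis .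
    qed
    then have "?Z' - k * of_real (r s) * Z s - of_real (g s) * Z s = 0"
      using q_nonzero[OF s'] by simp
    moreover have "(F has_vector_derivative exp (- (j * \<Theta> s)) * of_real (1 / sqrt (q s)) *
        (?Z' - k * of_real (r s) * Z s - of_real (g s) * Z s)) (at s)"
      unfolding F_def
      using has_vector_derivative_mult[OF E has_vector_derivative_mult[OF Z R]]
      by (simp add: algebra_simps add_divide_distrib \<omega>_def k_def)
    ultimately show "(F has_vector_derivative 0) (at s)" by simp
  qed
  \<comment> \<open>At \<open>0\<close> the phase and \<open>v1\<close> vanish, and
    \<open>v2 0 = 1 / \<omega>0\<close> equals \<open>sqrt (q 0)\<close> because
    \<open>\<omega>0\<close> is positive.\<close>
  also have "F 0 = 1"
    using \<omega>0 by (simp add: F_def Z_def \<Theta>_def antideriv0_def v_init q_0 real_sqrt_divide)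
  finally have "Z t = exp (j * \<Theta> t) * of_real (sqrt (q t))"
    using q_pos'[OF t] by (simp add: F_def exp_minus field_simps)
  then show ?thesis by (simp add: Z_def \<Theta>_def k_def)
qed

text \<open>Euler's formulas, from the cases \<open>j = \<i>\<close> and \<open>j = - \<i>\<close>.
  Both signs are used because the phase may be imaginary, where real and imaginary parts of one
  polar form do not separate cosine from sine.\<close>

lemma cos_sin_form:
  assumes t: "t \<in> Ico0 T"
  shows "cos (antideriv0 \<omega> t) * of_real (sqrt (q t)) = of_real (v2 t)"
    and "sin (antideriv0 \<omega> t) * of_real (sqrt (q t)) = c * of_real (v1 t)"
  using polar_form[of \<i>, OF _ t] polar_form[of "- \<i>", OF _ t]
  by (simp_all add: cos_exp_eq sin_exp_eq field_simps)

lemma solution_given_by_\<omega>: "solution_given_by T a b \<omega> \<phi> \<psi>"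
  unfolding solution_given_by_def
proof (intro conjI ballI allI impI)
  fix t assume t: "t \<in> Ico0 T"
  show "\<omega> absolutely_integrable_on {0..t}" "alpha a \<omega> absolutely_integrable_on {0..t}"
    by (intro continuous_on_Ico0_absolutely_integrable[OF _ t] \<omega>_continuous alpha_\<omega>_continuous)+
next
  show "\<exists>v. ivp_solution T a b \<phi> \<psi> v"
    \<comment> \<open>The coefficient \<open>\<phi> * \<omega>0\<close> of \<open>v2\<close> fits
      the value at \<open>0\<close>, where \<open>v1\<close> vanishes; the coefficient of
      \<open>v1\<close>, which has slope \<open>1\<close>, then corrects the slope.\<close>
    using ivp_solution_combination[OF v2 v1 T, of "\<phi> * \<omega>0"
        "\<psi> + \<phi> * (a 0 / 2 + \<omega>1 / (2 * \<omega>0))"] \<omega>0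
    by auto
next
  fix v t assume v: "ivp_solution T a b \<phi> \<psi> v" and t: "t \<in> Ico0 T"
  \<comment> \<open>\<open>A\<close> turns out to be \<open>alpha a \<omega> 0\<close>. Dividing the
    sine by \<open>\<omega> 0 = c * \<omega>0\<close> removes both the \<open>c\<close> of
    \<open>c * v1\<close> and the factor \<open>\<omega>0\<close> of the amplitude.\<close>
  define A where "A = a 0 / 2 + \<omega>1 / (2 * \<omega>0)"
  have "v t = \<phi> * \<omega>0 * v2 t + (\<psi> + A * \<phi>) * v1 t"
    using ivp_solution_eq_combination[OF v1 v2 v _ T a t, folded A_def] \<omega>0
    by (simp add: mult_ac)
  moreover have "alpha a \<omega> 0 = of_real A"
    using half_logderiv_\<omega>[OF zero_in_Ico0[OF T]] by (simp add: alpha_def h_0 A_def)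
  moreover have "cos (antideriv0 \<omega> t) * rho a \<omega> t = of_real \<omega>0 * of_real (v2 t)"
    using cos_sin_form(1)[OF t] by (simp add: rho_\<omega>[OF t] mult_ac)
  moreover have "sin (antideriv0 \<omega> t) / \<omega> 0 * rho a \<omega> t = of_real (v1 t)"
    using cos_sin_form(2)[OF t] \<omega>0 c_nonzero by (simp add: rho_\<omega>[OF t] \<omega>_0 field_simps)
  ultimately show "of_real (v t) = (of_real \<phi> * cos (antideriv0 \<omega> t)
      + (of_real \<psi> + alpha a \<omega> 0 * of_real \<phi>) * (sin (antideriv0 \<omega> t) / \<omega> 0)) * rho a \<omega> t"
    by (simp only: distrib_right mult.assoc) simp
qed

end

section \<open>Signs of the denominators and the two variants\<close>

lemma Ico0_nonzero_imp_pos: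
  fixes f :: "real \<Rightarrow> real"
  assumes "continuous_on (Ico0 T) f" "0 < f 0" "\<And>t. t \<in> Ico0 T \<Longrightarrow> f t \<noteq> 0" "t \<in> Ico0 T"
  shows "0 < f t"
proof (rule ccontr)
  assume "\<not> 0 < f t"
  have sub: "{0..t} \<subseteq> Ico0 T" by (rule Ico0_closed_below[OF assms(4)])
  have "\<exists>x\<ge>0. x \<le> t \<and> f x = 0"
    by (rule IVT2') (use \<open>\<not> 0 < f t\<close> assms(2,4) sub continuous_on_subset[OF assms(1) sub]
        in \<open>auto simp: Ico0_def\<close>)
  then show False using assms(3) sub by fastforce
qed

text \<open>Continuity at \<open>0\<close> guarantees that the imaginary variant speaks of at least
  one interval.\<close>

lemma pos_near_0:
  fixes f :: "real \<Rightarrow> real"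
  assumes "0 < T" "continuous_on (Ico0 T) f" "0 < f 0"
  obtains S where "0 < S" "S \<le> T" "\<And>t. t \<in> Ico0 S \<Longrightarrow> 0 < f t"
proof -
  have "eventually (\<lambda>t. 0 < f t) (at_right 0)"
    using continuous_on_Ico0_tendsto[OF assms(2,1)] assms(3) by (rule order_tendstoD(1))
  then obtain e where e: "0 < e" "\<And>t. 0 < t \<Longrightarrow> t < e \<Longrightarrow> 0 < f t"
    unfolding eventually_at_right_field by blast
  show thesis
  proof (rule that[of "min T (ereal e)"])
    show "0 < min T (ereal e)" using assms(1) e by simp
    fix t assume "t \<in> Ico0 (min T (ereal e))"
    then have "0 \<le> t" "t < e" by (auto simp: Ico0_def)
    then show "0 < f t" using e assms(3) by (cases "t = 0") auto
  qed simp
qed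

theorem theorem1:
  fixes T :: ereal and \<phi> \<psi> \<omega>0 \<omega>1 :: real and a b v1 v2 :: "real \<Rightarrow> real"
  assumes "0 < T"
    and "continuous_on (Ico0 T) a" and "continuous_on (Ico0 T) b"
    and "0 < \<omega>0"
    and "ivp_solution T a b 0 1 v1"
    and "ivp_solution T a b (1 / \<omega>0) (- (1 / \<omega>0) * (a 0 / 2 + \<omega>1 / (2 * \<omega>0))) v2"
  shows
    "((v1 0)\<^sup>2 + (v2 0)\<^sup>2 > 0 \<longrightarrow>
        (\<forall>t\<in>Ico0 T. (v1 t)\<^sup>2 + (v2 t)\<^sup>2 \<noteq> 0) \<and>
        frequency_function T a b (omega_real v1 v2) \<and>
        omega_real v1 v2 0 = of_real \<omega>0 \<and>
        (dt (omega_real v1 v2) \<longlongrightarrow> of_real \<omega>1) (at_right 0) \<and>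
        solution_given_by T a b (omega_real v1 v2) \<phi> \<psi>)
     \<and>
     ((v2 0)\<^sup>2 - (v1 0)\<^sup>2 > 0 \<longrightarrow>
        (\<exists>S. 0 < S \<and> S \<le> T \<and> (\<forall>t\<in>Ico0 S. (v2 t)\<^sup>2 - (v1 t)\<^sup>2 \<noteq> 0)) \<and>
        (\<forall>S. 0 < S \<and> S \<le> T \<and> (\<forall>t\<in>Ico0 S. (v2 t)\<^sup>2 - (v1 t)\<^sup>2 \<noteq> 0) \<longrightarrow>
           frequency_function S a b (omega_imag v1 v2) \<and>
           omega_imag v1 v2 0 = \<i> * of_real \<omega>0 \<and>
           (dt (omega_imag v1 v2) \<longlongrightarrow> \<i> * of_real \<omega>1) (at_right 0) \<and>
           solution_given_by S a b (omega_imag v1 v2) \<phi> \<psi>))"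
proof (intro conjI[of "_ \<longrightarrow> _"] impI)
  \<comment> \<open>A common zero of \<open>v1\<close> and \<open>v2\<close> would be a zero of the
    Wronskian, which Abel's identity excludes.\<close>
  have pos: "0 < (v1 t)\<^sup>2 + (v2 t)\<^sup>2" if "t \<in> Ico0 T" for t
  proof -
    have "wronskian v1 v2 t \<noteq> 0"
      using abel_identity[OF assms(5,6,1,2) that] assms(4) by simp
    then show ?thesis by (auto simp: wronskian_def sum_power2_gt_zero_iff)
  qed
  interpret amplitude_phase T a b v1 v2 \<omega>0 \<omega>1 1 1
    by unfold_locales (use assms pos in auto)
  have "\<omega> = omega_real v1 v2"
    by (simp add: fun_eq_iff \<omega>_def r_def q_def omega_real_def)
  then show "(\<forall>t\<in>Ico0 T. (v1 t)\<^sup>2 + (v2 t)\<^sup>2 \<noteq> 0) \<and>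
      frequency_function T a b (omega_real v1 v2) \<and>
      omega_real v1 v2 0 = of_real \<omega>0 \<and>
      (dt (omega_real v1 v2) \<longlongrightarrow> of_real \<omega>1) (at_right 0) \<and>
      solution_given_by T a b (omega_real v1 v2) \<phi> \<psi>"
    using pos frequency_function_\<omega> \<omega>_0 dt_\<omega>_tendsto solution_given_by_\<omega> by fastforce
next
  \<comment> \<open>This denominator can vanish later: \<open>a = b = 0\<close>,
    \<open>\<omega>0 = 1\<close>, \<open>\<omega>1 = 0\<close> gives \<open>1 - t\<^sup>2\<close>.
    Hence the argument runs on an arbitrary initial interval free of zeros.\<close>
  assume pos0: "(v2 0)\<^sup>2 - (v1 0)\<^sup>2 > 0"
  have cont: "continuous_on (Ico0 T) (\<lambda>t. (v2 t)\<^sup>2 - (v1 t)\<^sup>2)"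
    by (intro continuous_intros ivp_solution_continuous[OF assms(5,1)]
        ivp_solution_continuous[OF assms(6,1)])
  show "(\<exists>S. 0 < S \<and> S \<le> T \<and> (\<forall>t\<in>Ico0 S. (v2 t)\<^sup>2 - (v1 t)\<^sup>2 \<noteq> 0)) \<and>
      (\<forall>S. 0 < S \<and> S \<le> T \<and> (\<forall>t\<in>Ico0 S. (v2 t)\<^sup>2 - (v1 t)\<^sup>2 \<noteq> 0) \<longrightarrow>
         frequency_function S a b (omega_imag v1 v2) \<and>
         omega_imag v1 v2 0 = \<i> * of_real \<omega>0 \<and>
         (dt (omega_imag v1 v2) \<longlongrightarrow> \<i> * of_real \<omega>1) (at_right 0) \<and>
         solution_given_by S a b (omega_imag v1 v2) \<phi> \<psi>)"
  proof (rule conjI; (intro allI impI)?)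
    show "\<exists>S. 0 < S \<and> S \<le> T \<and> (\<forall>t\<in>Ico0 S. (v2 t)\<^sup>2 - (v1 t)\<^sup>2 \<noteq> 0)"
      using pos_near_0[OF assms(1) cont pos0] by (metis less_irrefl)
  next
    fix S assume S: "0 < S \<and> S \<le> T \<and> (\<forall>t\<in>Ico0 S. (v2 t)\<^sup>2 - (v1 t)\<^sup>2 \<noteq> 0)"
    then have sub: "Ico0 S \<subseteq> Ico0 T" by (simp add: Ico0_mono)
    \<comment> \<open>Positivity, which \<open>sqrt q\<close> and \<open>ln q\<close> rely on,
      propagates from \<open>0\<close> by the intermediate value theorem.\<close>
    have pos: "0 < (v2 t)\<^sup>2 - (v1 t)\<^sup>2" if "t \<in> Ico0 S" for t
      using Ico0_nonzero_imp_pos[OF continuous_on_subset[OF cont sub] pos0 _ that] S by blast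
    \<comment> \<open>All hypotheses restrict from \<open>T\<close> to \<open>S\<close> with the
      same initial data, so the common argument applies with end point \<open>S\<close>.\<close>
    interpret amplitude_phase S a b v1 v2 \<omega>0 \<omega>1 "-1" \<i>
      by unfold_locales
        (use S assms pos ivp_solution_mono continuous_on_subset[OF _ sub] in auto)
    have "\<omega> = omega_imag v1 v2"
      by (simp add: fun_eq_iff \<omega>_def r_def q_def omega_imag_def)
    then show "frequency_function S a b (omega_imag v1 v2) \<and>
        omega_imag v1 v2 0 = \<i> * of_real \<omega>0 \<and>
        (dt (omega_imag v1 v2) \<longlongrightarrow> \<i> * of_real \<omega>1) (at_right 0) \<and>
        solution_given_by S a b (omega_imag v1 v2) \<phi> \<psi>"
      using frequency_function_\<omega> \<omega>_0 dt_\<omega>_tendsto solution_given_by_\<omega> by simp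
  qed
qed

end
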